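(* Let $\mathbf f:[0,T]\to\mathbb R^{n_1\times\cdots\times n_d}$ be the exact solution of $\frac{d\mathbf f}{dt}=\mathbf N(\mathbf f)$, $\mathbf f(0)=\mathbf f_0$. Assume that $\mathbf N$ is Lipschitz continuous with constant $L$. Let $\mathbf\Phi(\mathbf N,\mathbf f,\Delta t)$ be an order-$p$ increment function satisfying the following stability condition: there exist constants $C,D,E\ge 0$ and a positive integer $m\le p$ such that, as $\Delta t\to 0$, $$\left\|\mathbf\Phi(\mathbf N,\hat{\mathbf f},\Delta t)-\mathbf\Phi(\mathbf N,\tilde{\mathbf f},\Delta t)\right\|_2\le (C+D\Delta t)\left\|\hat{\mathbf f}-\tilde{\mathbf f}\right\|_2+E\Delta t^m\qquad\text{for all }\hat{\mathbf f},\tilde{\mathbf f}\in\mathbb R^{n_1\times\cdots\times n_d}.$$ Let $\Delta t=T/N$, and consider the step-truncation method $$\mathbf f_{k+1}=\mathfrak T_{\mathbf r_k}(\mathbf a_k),\qquad \mathbf a_k=\mathbf f_k+\Delta t\,\mathbf\Phi(\mathbf N,\mathbf f_k,\Delta t),\qquad k=0,\dots,N-1,$$ where $\mathfrak T_{\mathbf r_k}=\mathfrak T^{\rm best}_{\mathbf r_k}$ or $\mathfrak T_{\mathbf r_k}=\mathfrak T^{\rm SVD}_{\mathbf r_k}$. Suppose the method is order-$p$ consistent, i.e. there is a constant $M>0$, independent of $k$ and $\Delta t$, such that the ranks $\mathbf r_k$ satisfy $\|\mathbf a_k-\mathfrak T_{\mathbf r_k}(\mathbf a_k)\|_2\le M\Delta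 t^{p+1}$ for all $k$. Then, for all sufficiently small $\Delta t$, the global error satisfies $$\|\mathbf f(T)-\mathbf f_N\|_2\le Q\,\Delta t^{z},\qquad z=\min(p,m),$$ where the constant $Q$ (independent of $\Delta t$) depends on the local error and stability coefficients of the increment function $\mathbf\Phi$ and on the truncation constant $M$.
   Context: Throughout, $d\ge2$, $\|\cdot\|_2$ is the Euclidean (Frobenius) norm on $\mathbb R^{n_1\times\cdots\times n_d}$, and $\mathbf N:\mathbb R^{n_1\times\cdots\times n_d}\to\mathbb R^{n_1\times\cdots\times n_d}$ is a (nonlinear) map. The integer $N$ (not bold) is the number of time steps on $[0,T]$; $t_k=k\Delta t$. Increment function of order $p$ ($p\ge1$ an integer): $\mathbf\Phi(\mathbf N,\cdot,\Delta t)$ maps tensors to tensors and defines the one-step scheme $\mathbf u_{k+1}=\mathbf u_k+\Delta t\,\mathbf\Phi(\mathbf N,\mathbf u_k,\Delta t)$. It has order $p$ if there is a constant $K$ such that for all sufficiently small $\Delta t>0$, and every starting tensor $\mathbf g$ under consideration (values of the exact solution and of the numerical iterates), $\|\mathbf y(\Delta t)-(\mathbf g+\Delta t\,\mathbf\Phi(\mathbf N,\mathbf g,\Delta t))\|_2\le K\Delta t^{p+1}$, where $\mathbf y'=\mathbf N(\mathbf y)$, $\mathbf y(0)=\mathbf g$. Hierarchical Tucker manifold: fix a dimension tree $\mathcal T_d$, i.e. a binary tree with root $\{1,\dots,d\}$, leaves the singletons, and every non-leaf node the disjoint union of its two children. For $\alpha\in\mathcal T_d$, the $\alpha$-matricization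 $\mathbf f^{(\alpha)}$ of $\mathbf f$ is the matrix with rows indexed by the modes in $\alpha$ and columns by the remaining modes. For $\mathbf r=\{r_\alpha\}_{\alpha\in\mathcal T_d}$, $\mathcal H_{\mathbf r}=\{\mathbf f:\operatorname{rank}\mathbf f^{(\alpha)}=r_\alpha\ \forall\alpha\in\mathcal T_d\}$ (with $\mathbf r$ such that this is nonempty), and its closure $\overline{\mathcal H}_{\mathbf r}$ consists of the tensors with $\operatorname{rank}\mathbf f^{(\alpha)}\le r_\alpha$ for all $\alpha$. Best truncation: $\mathfrak T^{\rm best}_{\mathbf r}(\mathbf f)\in\operatorname{argmin}_{\mathbf h\in\overline{\mathcal H}_{\mathbf r}}\|\mathbf f-\mathbf h\|_2$ (a fixed choice of minimizer). SVD truncation (HOSVD): $\mathfrak T^{\rm SVD}_{\mathbf r}(\mathbf f)=\prod_{\alpha\in\mathcal T_d^{\ell}}\mathbf P_\alpha\cdots\prod_{\alpha\in\mathcal T_d^{1}}\mathbf P_\alpha\,\mathbf f$, where $\mathcal T_d^1,\dots,\mathcal T_d^\ell$ are the layers of $\mathcal T_d$ (below the root, from top to bottom) and $\mathbf P_\alpha$ is the orthogonal projection acting on the $\alpha$-modes onto the span of $r_\alpha$ leading left singular vectors of $\mathbf f^{(\alpha)}$. It is known that $\|\mathbf f-\mathfrak T^{\rm best}_{\mathbf r}(\mathbf f)\|_2\le\|\mathbf f-\mathfrak T^{\rm SVD}_{\mathbf r}(\mathbf f)\|_2\le\sqrt{2d-3}\,\|\mathbf f-\mathfrak T^{\rm best}_{\mathbf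 r}(\mathbf f)\|_2$. The ranks $\mathbf r_k$ may change from step to step. *)

theory Defs
  imports "HOL-Analysis.Analysis" "HOL-Library.Function_Algebras"
begin

section \<open>Tensors and matricizations\<close>

definition multi_indices :: "(nat \<Rightarrow> nat) \<Rightarrow> nat set \<Rightarrow> (nat \<Rightarrow> nat) set" where
  "multi_indices n \<alpha> = (\<Pi>\<^sub>E k\<in>\<alpha>. {1..n k})"

text \<open>
  The space of \<open>n 1 \<times> \<dots> \<times> n d\<close> tensors is \<open>real ^ 'i\<close>, where the finite index type \<open>'i\<close>
  enumerates the multi-indices through a bijection \<open>ix\<close>: the entry of \<open>f\<close> at the multi-index
  \<open>\<mu>\<close> is \<open>f $ inv ix \<mu>\<close>. The norm of \<open>real ^ 'i\<close> is thus the Frobenius norm.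
\<close>

definition tensor_index :: "nat \<Rightarrow> (nat \<Rightarrow> nat) \<Rightarrow> ('i::finite \<Rightarrow> nat \<Rightarrow> nat) \<Rightarrow> bool" where
  "tensor_index d n ix \<longleftrightarrow> bij_betw ix UNIV (multi_indices n {1..d})"

text \<open>
  A matrix with finite row index set \<open>R\<close> and column index set \<open>C\<close> is a function of two arguments,
  considered only on \<open>R \<times> C\<close>. For the matricization with respect to \<open>\<alpha>\<close> these sets are
  \<open>multi_indices n \<alpha>\<close> and \<open>multi_indices n ({1..d} - \<alpha>)\<close>.
\<close>

definition matricize ::
    "nat \<Rightarrow> ('i::finite \<Rightarrow> nat \<Rightarrow> nat) \<Rightarrow> nat set \<Rightarrow> real ^ 'i
      \<Rightarrow> (nat \<Rightarrow> nat) \<Rightarrow> (nat \<Rightarrow> nat) \<Rightarrow> real" where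
  "matricize d ix \<alpha> f i j = f $ inv ix (merge \<alpha> ({1..d} - \<alpha>) (i, j))"

text \<open>
  The library's \<open>rank\<close> needs row and column index types, which cannot vary with \<open>\<alpha>\<close>. The rank is
  therefore the dimension of the span of the columns in the vector space of real functions
  (vanishing outside \<open>R\<close>) with pointwise operations.
\<close>

abbreviation (input) fun_scale :: "real \<Rightarrow> ('r \<Rightarrow> real) \<Rightarrow> 'r \<Rightarrow> real" where
  "fun_scale \<equiv> \<lambda>c g x. c * g x"

lemma vector_space_fun_scale: "vector_space fun_scale"
  by unfold_locales (auto simp: fun_eq_iff algebra_simps)

definition matrix_rank :: "'r set \<Rightarrow> 'c set \<Rightarrow> ('r \<Rightarrow> 'c \<Rightarrow> real) \<Rightarrow> nat" where
  "matrix_rank R C A =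
    vector_space.dim fun_scale ((\<lambda>j i. if i \<in> R then A i j else 0) ` C)"


section \<open>Dimension trees and the hierarchical Tucker manifold\<close>

text \<open>
  A node of the tree is identified with the set of modes at the leaves below it.
\<close>

datatype dtree = Leaf nat | Node dtree dtree

fun modes :: "dtree \<Rightarrow> nat set" where
  "modes (Leaf k) = {k}"
| "modes (Node l r) = modes l \<union> modes r"

fun disjoint_children :: "dtree \<Rightarrow> bool" where
  "disjoint_children (Leaf k) \<longleftrightarrow> True"
| "disjoint_children (Node l r) \<longleftrightarrow>
     modes l \<inter> modes r = {} \<and> disjoint_children l \<and> disjoint_children r"

definition dimension_tree :: "nat \<Rightarrow> dtree \<Rightarrow> bool" where
  "dimension_tree d t \<longleftrightarrow> modes t = {1..d} \<and> disjoint_children t"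

fun nodes :: "dtree \<Rightarrow> nat set set" where
  "nodes (Leaf k) = {{k}}"
| "nodes (Node l r) = insert (modes l \<union> modes r) (nodes l \<union> nodes r)"

fun depth :: "dtree \<Rightarrow> nat" where
  "depth (Leaf k) = 0"
| "depth (Node l r) = Suc (max (depth l) (depth r))"

text \<open>\<open>layer m t\<close> lists the nodes at distance \<open>m\<close> from the root.\<close>

fun layer :: "nat \<Rightarrow> dtree \<Rightarrow> nat set list" where
  "layer 0 t = [modes t]"
| "layer (Suc m) (Leaf k) = []"
| "layer (Suc m) (Node l r) = layer m l @ layer m r"

definition HT_manifold ::
    "nat \<Rightarrow> (nat \<Rightarrow> nat) \<Rightarrow> ('i::finite \<Rightarrow> nat \<Rightarrow> nat) \<Rightarrow> dtree \<Rightarrow> (nat set \<Rightarrow> nat)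
      \<Rightarrow> (real ^ 'i) set" where
  "HT_manifold d n ix t r =
    {f. \<forall>\<alpha>\<in>nodes t. matrix_rank (multi_indices n \<alpha>) (multi_indices n ({1..d} - \<alpha>))
                       (matricize d ix \<alpha> f) = r \<alpha>}"


section \<open>Truncation\<close>

definition is_best_truncation ::
    "nat \<Rightarrow> (nat \<Rightarrow> nat) \<Rightarrow> ('i::finite \<Rightarrow> nat \<Rightarrow> nat) \<Rightarrow> dtree \<Rightarrow> (nat set \<Rightarrow> nat)
      \<Rightarrow> real ^ 'i \<Rightarrow> real ^ 'i \<Rightarrow> bool" where
  "is_best_truncation d n ix t r f h \<longleftrightarrow>
    is_arg_min (\<lambda>h. norm (f - h)) (\<lambda>h. h \<in> closure (HT_manifold d n ix t r)) h"

definition orthonormal_vectors :: "'r set \<Rightarrow> (nat \<Rightarrow> 'r \<Rightarrow> real) \<Rightarrow> bool" where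
  "orthonormal_vectors R U \<longleftrightarrow>
    (\<forall>k<card R. \<forall>l<card R. (\<Sum>i\<in>R. U k i * U l i) = (if k = l then 1 else 0))"

text \<open>
  Full singular value decomposition; \<open>U k\<close> is the left singular vector for the singular value
  \<open>s k\<close>, and the singular values are in decreasing order.
\<close>

definition is_svd ::
    "'r set \<Rightarrow> 'c set \<Rightarrow> ('r \<Rightarrow> 'c \<Rightarrow> real)
      \<Rightarrow> (nat \<Rightarrow> 'r \<Rightarrow> real) \<Rightarrow> (nat \<Rightarrow> real) \<Rightarrow> (nat \<Rightarrow> 'c \<Rightarrow> real) \<Rightarrow> bool" where
  "is_svd R C A U s V \<longleftrightarrow>
    orthonormal_vectors R U \<and> orthonormal_vectors C V \<and> decseq s \<and> (\<forall>k. 0 \<le> s k) \<and>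
    (\<forall>i\<in>R. \<forall>j\<in>C. A i j = (\<Sum>k<min (card R) (card C). s k * U k i * V k j))"

text \<open>
  Orthogonal projection, acting on the modes in \<open>\<alpha>\<close>, onto the span of \<open>U 0, \<dots>, U (\<rho> - 1)\<close>: the
  \<open>\<alpha>\<close>-matricization of \<open>g\<close> is multiplied from the left by the sum of \<open>U k (U k)\<^sup>T\<close> over \<open>k < \<rho>\<close>.
\<close>

definition mode_projection ::
    "nat \<Rightarrow> (nat \<Rightarrow> nat) \<Rightarrow> ('i::finite \<Rightarrow> nat \<Rightarrow> nat) \<Rightarrow> nat set \<Rightarrow> nat
      \<Rightarrow> (nat \<Rightarrow> (nat \<Rightarrow> nat) \<Rightarrow> real) \<Rightarrow> real ^ 'i \<Rightarrow> real ^ 'i" where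
  "mode_projection d n ix \<alpha> \<rho> U g =
    (\<chi> x. \<Sum>k<\<rho>. U k (restrict (ix x) \<alpha>) *
           (\<Sum>i\<in>multi_indices n \<alpha>. U k i * matricize d ix \<alpha> g i (restrict (ix x) ({1..d} - \<alpha>))))"

text \<open>
  All projections are computed from the tensor \<open>f\<close> itself, and \<open>fold\<close> applies those of the topmost
  layer first. The singular vectors need not be unique, hence a relation.
\<close>

definition is_svd_truncation ::
    "nat \<Rightarrow> (nat \<Rightarrow> nat) \<Rightarrow> ('i::finite \<Rightarrow> nat \<Rightarrow> nat) \<Rightarrow> dtree \<Rightarrow> (nat set \<Rightarrow> nat)
      \<Rightarrow> real ^ 'i \<Rightarrow> real ^ 'i \<Rightarrow> bool" where
  "is_svd_truncation d n ix t r f h \<longleftrightarrow>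
    (\<exists>U. (\<forall>\<alpha>\<in>nodes t - {{1..d}}. \<exists>s V.
            is_svd (multi_indices n \<alpha>) (multi_indices n ({1..d} - \<alpha>)) (matricize d ix \<alpha> f)
              (U \<alpha>) s V) \<and>
         h = fold (\<lambda>\<alpha>. mode_projection d n ix \<alpha> (r \<alpha>) (U \<alpha>))
               (concat (map (\<lambda>m. layer m t) [1..<Suc (depth t)])) f)"

text \<open>
  The operator \<open>Tr\<close> is a fixed choice of best truncations, or a fixed choice of SVD truncations.
\<close>

definition truncation_operator ::
    "nat \<Rightarrow> (nat \<Rightarrow> nat) \<Rightarrow> ('i::finite \<Rightarrow> nat \<Rightarrow> nat) \<Rightarrow> dtree
      \<Rightarrow> ((nat set \<Rightarrow> nat) \<Rightarrow> real ^ 'i \<Rightarrow> real ^ 'i) \<Rightarrow> bool" where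
  "truncation_operator d n ix t Tr \<longleftrightarrow>
    (\<forall>r f. HT_manifold d n ix t r \<noteq> {} \<longrightarrow> is_best_truncation d n ix t r f (Tr r f)) \<or>
    (\<forall>r f. HT_manifold d n ix t r \<noteq> {} \<longrightarrow> is_svd_truncation d n ix t r f (Tr r f))"


section \<open>Time stepping\<close>

definition is_solution ::
    "('a::real_normed_vector \<Rightarrow> 'a) \<Rightarrow> 'a \<Rightarrow> real \<Rightarrow> (real \<Rightarrow> 'a) \<Rightarrow> bool" where
  "is_solution N g b y \<longleftrightarrow>
    y 0 = g \<and> (\<forall>t\<in>{0..b}. (y has_vector_derivative N (y t)) (at t within {0..b}))"

definition one_step ::
    "('a \<Rightarrow> 'a) \<Rightarrow> (('a \<Rightarrow> 'a) \<Rightarrow> 'a \<Rightarrow> real \<Rightarrow> 'a) \<Rightarrow> real \<Rightarrow> 'a::real_normed_vector \<Rightarrow> 'a" where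
  "one_step N \<Phi> h u = u + h *\<^sub>R \<Phi> N u h"

text \<open>
  \<open>G h\<close> is the set of starting tensors under consideration for the step size \<open>h\<close>.
\<close>

definition increment_of_order ::
    "nat \<Rightarrow> real \<Rightarrow> (real \<Rightarrow> 'a set) \<Rightarrow> ('a \<Rightarrow> 'a)
      \<Rightarrow> (('a \<Rightarrow> 'a) \<Rightarrow> 'a \<Rightarrow> real \<Rightarrow> 'a::real_normed_vector) \<Rightarrow> bool" where
  "increment_of_order p K G N \<Phi> \<longleftrightarrow>
    (\<forall>\<^sub>F h in at_right 0. \<forall>g\<in>G h. \<forall>y. is_solution N g h y \<longrightarrow>
       norm (y h - one_step N \<Phi> h g) \<le> K * h ^ (p + 1))"

definition stable_increment ::
    "real \<Rightarrow> real \<Rightarrow> real \<Rightarrow> nat \<Rightarrow> ('a \<Rightarrow> 'a)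
      \<Rightarrow> (('a \<Rightarrow> 'a) \<Rightarrow> 'a \<Rightarrow> real \<Rightarrow> 'a::real_normed_vector) \<Rightarrow> bool" where
  "stable_increment C D E m N \<Phi> \<longleftrightarrow>
    (\<forall>\<^sub>F h in at_right 0. \<forall>u v.
       norm (\<Phi> N u h - \<Phi> N v h) \<le> (C + D * h) * norm (u - v) + E * h ^ m)"

primrec step_truncation ::
    "('a \<Rightarrow> 'a) \<Rightarrow> (('a \<Rightarrow> 'a) \<Rightarrow> 'a \<Rightarrow> real \<Rightarrow> 'a) \<Rightarrow> ('r \<Rightarrow> 'a \<Rightarrow> 'a) \<Rightarrow> real
      \<Rightarrow> (nat \<Rightarrow> 'r) \<Rightarrow> 'a::real_normed_vector \<Rightarrow> nat \<Rightarrow> 'a" where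
  "step_truncation N \<Phi> Tr h r f0 0 = f0"
| "step_truncation N \<Phi> Tr h r f0 (Suc k) =
     Tr (r k) (one_step N \<Phi> h (step_truncation N \<Phi> Tr h r f0 k))"

end

theory Submission
  imports Defs
begin

text \<open>
  This is the classical convergence argument "stability plus consistency", with the truncation
  as one more local perturbation. Write \<open>h = T / S\<close> for the step size, \<open>t\<^sub>k = k h\<close>, and let
  \<open>e\<^sub>k\<close> be the norm of \<open>f t\<^sub>k - u\<^sub>k\<close>. Between \<open>f t\<^sub>k\<^sub>+\<^sub>1\<close> and \<open>u\<^sub>k\<^sub>+\<^sub>1\<close> two intermediate tensors are
  inserted: one untruncated step from \<open>f t\<^sub>k\<close>, and one untruncated step from \<open>u\<^sub>k\<close>. The first of
  the three resulting distances is a local error, at most \<open>K h\<^sup>p\<^sup>+\<^sup>1\<close>; the second is controlled by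
  stability, at most \<open>(1 + h (C + D h)) e\<^sub>k + E h\<^sup>m\<^sup>+\<^sup>1\<close>; the third is the truncation error, at
  most \<open>M h\<^sup>p\<^sup>+\<^sup>1\<close>. Starting the local comparison on the exact trajectory, rather than at the
  iterate \<open>u\<^sub>k\<close>, makes its exact solution a time shift of \<open>f\<close> (\<open>is_solution_shift\<close>).

  The recursion (\<open>truncated_step_error\<close>) has the form \<open>e\<^sub>k\<^sub>+\<^sub>1 \<le> (1 + h a) e\<^sub>k + c\<close> with \<open>a = C + D T\<close>
  and \<open>e\<^sub>0 = 0\<close>, so a discrete Gronwall estimate (\<open>affine_recursion_bound\<close>) gives \<open>e\<^sub>S \<le> S c exp (a T)\<close>.
  As \<open>c\<close> is of order \<open>h\<^sup>m\<^sup>+\<^sup>1\<close> and \<open>S h = T\<close>, one power of \<open>h\<close> is lost in the summation and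
  \<open>h\<^sup>m\<close> remains. The estimates are stated in an arbitrary real normed space, where the
  truncation is a perturbation of size \<open>M h\<^sup>p\<^sup>+\<^sup>1\<close>.
\<close>

lemma is_solution_shift:
  assumes sol: "is_solution N g b y" and "0 \<le> s" "s + h \<le> b"
  shows "is_solution N (y s) h (\<lambda>t. y (s + t))"
  unfolding is_solution_def
proof (intro conjI ballI)
  fix t assume t: "t \<in> {0..h}"
  have "(y has_vector_derivative N (y (s + t))) (at (s + t) within {0..b})"
    using sol t assms(2,3) by (simp add: is_solution_def)
  then have "(y has_vector_derivative N (y (s + t))) (at (s + t) within (+) s ` {0..h})"
    using assms(2,3) by (rule_tac has_vector_derivative_within_subset) auto
  moreover have "((+) s has_vector_derivative 1) (at t within {0..h})"
    by (auto intro!: derivative_eq_intros)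
  ultimately show "((\<lambda>t. y (s + t)) has_vector_derivative N (y (s + t))) (at t within {0..h})"
    using vector_diff_chain_within[of "(+) s" 1 t "{0..h}" y "N (y (s + t))"]
    by (simp add: o_def)
qed simp

text \<open>
  Since \<open>A \<ge> 1\<close>, the geometric sum \<open>1 + A + \<dots> + A ^ (k - 1)\<close> of the exact solution of the
  recursion may be replaced by \<open>k * A ^ k\<close>; this keeps \<open>A = 1\<close> from being a special case.
\<close>

lemma affine_recursion_bound:
  fixes e :: "nat \<Rightarrow> real"
  assumes "e 0 \<le> 0" "1 \<le> A" "0 \<le> c"
    and step: "\<And>k. k < S \<Longrightarrow> e (Suc k) \<le> A * e k + c"
  shows "k \<le> S \<Longrightarrow> e k \<le> real k * c * A ^ k"
proof (induction k)
  case 0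
  then show ?case using assms(1) by simp
next
  case (Suc k)
  have "e (Suc k) \<le> A * e k + c"
    using step Suc.prems by simp
  also have "\<dots> \<le> A * (real k * c * A ^ k) + c * A ^ Suc k"
  proof (rule add_mono)
    show "A * e k \<le> A * (real k * c * A ^ k)"
      using Suc assms(2) by (intro mult_left_mono) auto
    show "c \<le> c * A ^ Suc k"
      using mult_left_mono[OF one_le_power[OF assms(2), of "Suc k"] assms(3)] by simp
  qed
  also have "\<dots> = real (Suc k) * c * A ^ Suc k"
    by (simp add: algebra_simps)
  finally show ?case .
qed

lemma one_step_stability:
  assumes "0 \<le> h"
    and "norm (\<Phi> N v h - \<Phi> N w h) \<le> a * norm (v - w) + b"
  shows "norm (one_step N \<Phi> h v - one_step N \<Phi> h w) \<le> (1 + h * a) * norm (v - w) + h * b"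
proof -
  have "norm (one_step N \<Phi> h v - one_step N \<Phi> h w)
      = norm ((v - w) + h *\<^sub>R (\<Phi> N v h - \<Phi> N w h))"
    by (simp add: one_step_def algebra_simps)
  also have "\<dots> \<le> norm (v - w) + h * norm (\<Phi> N v h - \<Phi> N w h)"
    using norm_triangle_ineq[of "v - w" "h *\<^sub>R (\<Phi> N v h - \<Phi> N w h)"] assms(1) by simp
  also have "\<dots> \<le> norm (v - w) + h * (a * norm (v - w) + b)"
    using assms by (intro add_left_mono mult_left_mono) auto
  finally show ?thesis by (simp add: algebra_simps)
qed

text \<open>
  Error propagation over one step: \<open>x\<close> and \<open>w\<close> are the exact and the computed value at the start
  of the step, \<open>x'\<close> and \<open>w'\<close> those at its end.
\<close>

lemma truncated_step_error:
  assumes "0 \<le> h"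
    and "norm (x' - one_step N \<Phi> h x) \<le> \<kappa>"
    and "norm (\<Phi> N x h - \<Phi> N w h) \<le> a * norm (x - w) + b"
    and "norm (one_step N \<Phi> h w - w') \<le> \<mu>"
  shows "norm (x' - w') \<le> (1 + h * a) * norm (x - w) + (\<kappa> + \<mu> + h * b)"
proof -
  have "norm (x' - w') \<le> norm (x' - one_step N \<Phi> h x)
      + norm (one_step N \<Phi> h x - one_step N \<Phi> h w) + norm (one_step N \<Phi> h w - w')"
    by norm
  moreover have "norm (one_step N \<Phi> h x - one_step N \<Phi> h w) \<le> (1 + h * a) * norm (x - w) + h * b"
    by (rule one_step_stability[where \<Phi> = \<Phi> and N = N, OF assms(1,3)])
  ultimately show ?thesis using assms(2,4) by linarith
qed

text \<open>
  For a fixed number \<open>S\<close> of steps the asymptotic conditions on \<open>\<Phi>\<close> and on the truncation become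
  inequalities at the single step size \<open>h\<close>, and the one-step errors can be accumulated. The crude
  bound \<open>h \<le> T\<close> makes the constant independent of \<open>h\<close>; the factor \<open>T ^ (p - m)\<close> turns the local
  error order \<open>p + 1\<close> into \<open>m + 1\<close>, and \<open>\<bar>K\<bar>\<close> stands for \<open>K\<close> to keep the recursion's
  inhomogeneity nonnegative.
\<close>

lemma truncated_one_step_global_error:
  fixes f :: "real \<Rightarrow> 'a::real_normed_vector" and u :: "nat \<Rightarrow> 'a"
  assumes "0 < T" "0 \<le> C" "0 \<le> D" "0 \<le> E" "0 \<le> M" "m \<le> p" "0 < S"
    and h: "h = T / real S"
    and sol: "is_solution N f0 T f" and init: "u 0 = f0"
    and order: "\<And>s y. \<lbrakk>s \<in> {0..T}; is_solution N (f s) h y\<rbrakk>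
                  \<Longrightarrow> norm (y h - one_step N \<Phi> h (f s)) \<le> K * h ^ (p + 1)"
    and stable: "\<And>v w. norm (\<Phi> N v h - \<Phi> N w h) \<le> (C + D * h) * norm (v - w) + E * h ^ m"
    and trunc: "\<And>k. k < S \<Longrightarrow> norm (one_step N \<Phi> h (u k) - u (Suc k)) \<le> M * h ^ (p + 1)"
  shows "norm (f T - u S)
    \<le> T * ((\<bar>K\<bar> + M) * T ^ (p - m) + E) * exp (T * (C + D * T)) * h ^ m"
proof -
  define a where "a = C + D * T"
  define B where "B = (\<bar>K\<bar> + M) * T ^ (p - m) + E"
  have h0: "0 < h" and Sh: "real S * h = T" and hT: "h \<le> T"
    using assms(1,7) by (auto simp: h field_simps)
  have a0: "0 \<le> a" and B0: "0 \<le> B" using assms(1-5) by (simp_all add: a_def B_def)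
  have hp: "h ^ (p + 1) \<le> T ^ (p - m) * h ^ (m + 1)"
  proof -
    have "h ^ (p + 1) = h ^ (p - m) * h ^ (m + 1)"
      using assms(6) by (simp flip: power_add)
    also have "\<dots> \<le> T ^ (p - m) * h ^ (m + 1)"
      using h0 hT by (intro mult_right_mono power_mono) auto
    finally show ?thesis .
  qed
  define e where "e k = norm (f (real k * h) - u k)" for k
  have "e (Suc k) \<le> (1 + h * a) * e k + B * h ^ (m + 1)" if k: "k < S" for k
  proof -
    have "real (Suc k) * h \<le> real S * h"
      using k h0 by (intro mult_right_mono) auto
    then have grid: "0 \<le> real k * h" "real k * h + h \<le> T"
      using h0 Sh by (auto simp: algebra_simps)
    have "norm (f (real k * h + h) - one_step N \<Phi> h (f (real k * h))) \<le> K * h ^ (p + 1)"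
      using order[OF _ is_solution_shift[OF sol grid]] grid h0 by simp
    then have "norm (f (real k * h + h) - u (Suc k))
      \<le> (1 + h * (C + D * h)) * norm (f (real k * h) - u k)
        + (K * h ^ (p + 1) + M * h ^ (p + 1) + h * (E * h ^ m))"
      using h0 by (intro truncated_step_error[where \<Phi> = \<Phi> and N = N] stable trunc[OF k]) auto
    then have "e (Suc k) \<le> (1 + h * (C + D * h)) * e k
        + (K * h ^ (p + 1) + M * h ^ (p + 1) + h * (E * h ^ m))"
      by (simp add: e_def algebra_simps)
    also have "\<dots> \<le> (1 + h * a) * e k + B * h ^ (m + 1)"
    proof (rule add_mono)
      have "C + D * h \<le> a"
        using hT assms(3) by (simp add: a_def mult_left_mono)
      then show "(1 + h * (C + D * h)) * e k \<le> (1 + h * a) * e k"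
        using h0 by (intro mult_right_mono) (auto simp: e_def)
      have "(K + M) * h ^ (p + 1) \<le> (\<bar>K\<bar> + M) * h ^ (p + 1)"
        using h0 by (intro mult_right_mono) auto
      also have "\<dots> \<le> (\<bar>K\<bar> + M) * (T ^ (p - m) * h ^ (m + 1))"
        using hp assms(5) by (intro mult_left_mono) auto
      finally show "K * h ^ (p + 1) + M * h ^ (p + 1) + h * (E * h ^ m) \<le> B * h ^ (m + 1)"
        by (simp add: B_def algebra_simps)
    qed
    finally show ?thesis .
  qed
  moreover have "e 0 \<le> 0"
    using sol init by (simp add: e_def is_solution_def)
  ultimately have "e S \<le> real S * (B * h ^ (m + 1)) * (1 + h * a) ^ S"
    using h0 a0 B0 by (intro affine_recursion_bound[where S = S]) auto
  also have "\<dots> \<le> real S * (B * h ^ (m + 1)) * exp (T * a)"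
  proof (rule mult_left_mono)
    have "(1 + h * a) ^ S \<le> exp (h * a) ^ S"
      using h0 a0 by (intro power_mono) auto
    also have "\<dots> = exp (T * a)"
      by (simp flip: exp_of_nat_mult add: Sh mult.assoc[symmetric])
    finally show "(1 + h * a) ^ S \<le> exp (T * a)" .
  qed (use h0 B0 in simp)
  also have "\<dots> = T * B * exp (T * a) * h ^ m"
  proof -
    have "real S * (B * h ^ (m + 1)) * exp (T * a) = (real S * h) * B * exp (T * a) * h ^ m"
      by simp
    then show ?thesis by (simp only: Sh)
  qed
  finally show ?thesis
    by (simp add: e_def a_def B_def Sh)
qed

lemma filterlim_step_size:
  fixes T :: real
  assumes "0 < T"
  shows "filterlim (\<lambda>S. T / real S) (at_right 0) sequentially"
proof (rule tendsto_imp_filterlim_at_right)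
  show "(\<lambda>S. T / real S) \<longlonglongrightarrow> 0" by (rule lim_const_over_n)
  show "\<forall>\<^sub>F S in sequentially. 0 < T / real S"
    using eventually_gt_at_top[of 0] by eventually_elim (use assms in simp)
qed

theorem theorem1:
  fixes T C D E K M :: real and p m :: nat
  assumes "T > 0" and "C \<ge> 0" and "D \<ge> 0" and "E \<ge> 0" and "M > 0"
    and "1 \<le> m" and "m \<le> p"
  shows "\<exists>Q::real.
    \<forall>(d::nat) (n::nat \<Rightarrow> nat) (ix::'i::finite \<Rightarrow> nat \<Rightarrow> nat) (tree::dtree)
     (N::real ^ 'i \<Rightarrow> real ^ 'i) (L::real) (f0::real ^ 'i) (f::real \<Rightarrow> real ^ 'i)
     (\<Phi>::(real ^ 'i \<Rightarrow> real ^ 'i) \<Rightarrow> real ^ 'i \<Rightarrow> real \<Rightarrow> real ^ 'i)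
     (Tr::(nat set \<Rightarrow> nat) \<Rightarrow> real ^ 'i \<Rightarrow> real ^ 'i)
     (r::nat \<Rightarrow> nat \<Rightarrow> nat set \<Rightarrow> nat) (u::nat \<Rightarrow> nat \<Rightarrow> real ^ 'i).
      d \<ge> 2 \<longrightarrow> tensor_index d n ix \<longrightarrow> dimension_tree d tree \<longrightarrow>
      L-lipschitz_on UNIV N \<longrightarrow>
      is_solution N f0 T f \<longrightarrow>
      truncation_operator d n ix tree Tr \<longrightarrow>
      (\<forall>S>0. \<forall>k<S. HT_manifold d n ix tree (r S k) \<noteq> {}) \<longrightarrow>
      (\<forall>S>0. \<forall>k\<le>S. u S k = step_truncation N \<Phi> Tr (T / real S) (r S) f0 k) \<longrightarrow>
      increment_of_order p K
        (\<lambda>h. f ` {0..T} \<union> {u S k | S k. 0 < S \<and> h = T / real S \<and> k \<le> S}) N \<Phi> \<longrightarrow>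
      stable_increment C D E m N \<Phi> \<longrightarrow>
      (\<forall>\<^sub>F S in sequentially. \<forall>k<S.
         norm (one_step N \<Phi> (T / real S) (u S k)
               - Tr (r S k) (one_step N \<Phi> (T / real S) (u S k)))
           \<le> M * (T / real S) ^ (p + 1)) \<longrightarrow>
      (\<forall>\<^sub>F S in sequentially. norm (f T - u S S) \<le> Q * (T / real S) ^ min p m)"
proof (rule exI[of _ "T * ((\<bar>K\<bar> + M) * T ^ (p - m) + E) * exp (T * (C + D * T))"],
    intro allI impI, goal_cases)
  case (1 d n ix tree N L f0 f \<Phi> Tr r u)
  let ?G = "\<lambda>h. f ` {0..T} \<union> {u S k | S k. 0 < S \<and> h = T / real S \<and> k \<le> S}"
  note sol = 1(5) and scheme = 1(8) and order = 1(9) and stable = 1(10) and trunc = 1(11)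
  note step_size = filterlim_step_size[OF \<open>T > 0\<close>]
  from order have order': "\<forall>\<^sub>F S in sequentially. \<forall>g\<in>?G (T / real S). \<forall>y.
      is_solution N g (T / real S) y \<longrightarrow>
      norm (y (T / real S) - one_step N \<Phi> (T / real S) g) \<le> K * (T / real S) ^ (p + 1)"
    unfolding increment_of_order_def by (rule eventually_compose_filterlim[OF _ step_size])
  from stable have stable': "\<forall>\<^sub>F S in sequentially. \<forall>v w.
      norm (\<Phi> N v (T / real S) - \<Phi> N w (T / real S))
        \<le> (C + D * (T / real S)) * norm (v - w) + E * (T / real S) ^ m"
    unfolding stable_increment_def by (rule eventually_compose_filterlim[OF _ step_size])
  from order' stable' trunc eventually_gt_at_top[of 0] show ?case
  proof eventually_elim
    case (elim S)
    have init: "u S 0 = f0"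
      using scheme elim(4) by simp
    have next_iterate: "u S (Suc k) = Tr (r S k) (one_step N \<Phi> (T / real S) (u S k))"
      if "k < S" for k
      using scheme elim(4) that by simp
    have "norm (f T - u S S) \<le> T * ((\<bar>K\<bar> + M) * T ^ (p - m) + E) * exp (T * (C + D * T))
        * (T / real S) ^ m"
    proof (rule truncated_one_step_global_error[where u = "u S", OF _ _ _ _ _ _ _ refl sol init])
      show "norm (y (T / real S) - one_step N \<Phi> (T / real S) (f s)) \<le> K * (T / real S) ^ (p + 1)"
        if "s \<in> {0..T}" "is_solution N (f s) (T / real S) y" for s y
        using elim(1) that by blast
    qed (use assms elim next_iterate in auto)
    then show ?case
      using assms(7) by (simp add: min_absorb2)
  qed
qed

end
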